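(* Let $G=(V,E)$ be a finite graph and let ${\rm vc}(G)$ denote the size of a minimum vertex cover of $G$. Consider the optimization problem over families of vectors $\{{\bf v}_i : i\in\{0\}\cup V\}\subseteq\mathbb{R}^m$ ($m$ arbitrary): $$\text{minimize } \sum_{i\in V}\Big(1-\tfrac{\|{\bf v}_0-{\bf v}_i\|^2}{4}\Big)$$ subject to (i) $\|{\bf v}_i-{\bf v}_0\|^2+\|{\bf v}_j-{\bf v}_0\|^2=\|{\bf v}_i-{\bf v}_j\|^2$ for every edge $ij\in E$; (ii) $\|{\bf v}_i\|=1$ for every $i\in\{0\}\cup V$; (iii) the distance $d(i,j)=\|{\bf v}_i-{\bf v}_j\|^2$ on the point set $\{{\bf v}_i: i\in\{0\}\cup V\}$ is isometrically embeddable into $\ell_1$, i.e. there exist $M$ and $\phi:\{{\bf v}_i\}\to\mathbb{R}^M$ with $\|\phi({\bf v}_i)-\phi({\bf v}_j)\|_1=\|{\bf v}_i-{\bf v}_j\|^2$ for all $i,j$. Then the optimal value of this problem equals ${\rm vc}(G)$.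
   Context: $\|\cdot\|$ is the Euclidean norm and $\|\cdot\|_1$ the $\ell_1$ norm. A vertex cover of $G$ is a set $S\subseteq V$ meeting every edge. *)

theory Defs
  imports "HOL-Analysis.Analysis"
begin

text \<open>
  The dimension is quantified inside the optimization problem, so it cannot be a type.
  A vector of \<open>\<real>\<^sup>m\<close> is an element of \<^term>\<open>topspace (Euclidean_space m)\<close>, i.e. a function
  \<^typ>\<open>nat \<Rightarrow> real\<close> vanishing at all indices \<open>\<ge> m\<close>; subtraction is pointwise.
\<close>

abbreviation Rvec :: "nat \<Rightarrow> (nat \<Rightarrow> real) set" where
  "Rvec m \<equiv> topspace (Euclidean_space m)"

definition l2_norm :: "nat \<Rightarrow> (nat \<Rightarrow> real) \<Rightarrow> real" where
  "l2_norm m x = L2_set x {..<m}"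

definition l1_norm :: "nat \<Rightarrow> (nat \<Rightarrow> real) \<Rightarrow> real" where
  "l1_norm m x = (\<Sum>k<m. \<bar>x k\<bar>)"

definition l1_embeddable :: "'p set \<Rightarrow> ('p \<Rightarrow> 'p \<Rightarrow> real) \<Rightarrow> bool" where
  "l1_embeddable X d \<longleftrightarrow>
     (\<exists>M. \<exists>\<phi> \<in> X \<rightarrow> Rvec M. \<forall>x\<in>X. \<forall>y\<in>X. l1_norm M (\<phi> x - \<phi> y) = d x y)"

definition finite_graph :: "'a set \<Rightarrow> 'a set set \<Rightarrow> bool" where
  "finite_graph V E \<longleftrightarrow> finite V \<and> (\<forall>e\<in>E. e \<subseteq> V \<and> card e = 2)"

definition vertex_cover :: "'a set \<Rightarrow> 'a set set \<Rightarrow> 'a set \<Rightarrow> bool" where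
  "vertex_cover V E S \<longleftrightarrow> S \<subseteq> V \<and> (\<forall>e\<in>E. S \<inter> e \<noteq> {})"

definition vc :: "'a set \<Rightarrow> 'a set set \<Rightarrow> nat" where
  "vc V E = Min (card ` {S. vertex_cover V E S})"

text \<open>
  The index set \<open>{0} \<union> V\<close> is rendered as a subset of \<^typ>\<open>'a option\<close>, with
  \<^term>\<open>None\<close> as the extra index \<open>0\<close>.
\<close>

definition indices :: "'a set \<Rightarrow> 'a option set" where
  "indices V = insert None (Some ` V)"

definition feasible ::
  "'a set \<Rightarrow> 'a set set \<Rightarrow> nat \<Rightarrow> ('a option \<Rightarrow> nat \<Rightarrow> real) \<Rightarrow> bool" where
  "feasible V E m v \<longleftrightarrow>
     (\<forall>i\<in>indices V. v i \<in> Rvec m) \<and>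
     (\<forall>i j. {i, j} \<in> E \<longrightarrow>
        (l2_norm m (v (Some i) - v None))\<^sup>2 + (l2_norm m (v (Some j) - v None))\<^sup>2
          = (l2_norm m (v (Some i) - v (Some j)))\<^sup>2) \<and>
     (\<forall>i\<in>indices V. l2_norm m (v i) = 1) \<and>
     l1_embeddable (v ` indices V) (\<lambda>x y. (l2_norm m (x - y))\<^sup>2)"

definition objective :: "'a set \<Rightarrow> nat \<Rightarrow> ('a option \<Rightarrow> nat \<Rightarrow> real) \<Rightarrow> real" where
  "objective V m v = (\<Sum>i\<in>V. 1 - (l2_norm m (v None - v (Some i)))\<^sup>2 / 4)"

text \<open>
  The infimum is taken in \<^typ>\<open>ereal\<close>, where it is meaningful also for empty or unbounded
  sets, unlike \<^term>\<open>Inf\<close> on \<^typ>\<open>real\<close>.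
\<close>

definition optimal_value :: "'a set \<Rightarrow> 'a set set \<Rightarrow> ereal" where
  "optimal_value V E = Inf {ereal (objective V m v) | m v. feasible V E m v}"

end

theory Submission imports Defs begin

text \<open>
  A vertex cover \<open>S\<close> gives a feasible point of value \<open>|S|\<close>: put \<open>v\<^sub>i = v\<^sub>0\<close> on \<open>S\<close> and
  \<open>v\<^sub>i = -v\<^sub>0\<close> elsewhere.

  Conversely, let \<open>x\<^sub>i = v\<^sub>i - v\<^sub>0\<close>, \<open>d\<^sub>i = |x\<^sub>i|\<^sup>2\<close> and \<open>D = \<Sum>\<^sub>i d\<^sub>i\<close>. As all vectors have norm 1,
  \<open>d\<^sub>i = -2 x\<^sub>i \<cdot> v\<^sub>0\<close>, so \<open>D\<^sup>2 \<le> 4 |\<Sum>\<^sub>i x\<^sub>i|\<^sup>2 = 4 \<Sum>\<^sub>i\<^sub>j x\<^sub>i \<cdot> x\<^sub>j\<close> by Cauchy--Schwarz.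
  If \<open>a\<^sub>i\<close> is the image of \<open>v\<^sub>i\<close> under an \<open>\<ell>\<^sub>1\<close>-embedding that maps \<open>v\<^sub>0\<close> to the origin, then
  \<open>x\<^sub>i \<cdot> x\<^sub>j = (d\<^sub>i + d\<^sub>j - d\<^sub>i\<^sub>j)/2\<close> is the sum over the coordinates \<open>k\<close> of the Gromov products
  \<open>(|a\<^sub>i\<^sub>k| + |a\<^sub>j\<^sub>k| - |a\<^sub>i\<^sub>k - a\<^sub>j\<^sub>k|)/2\<close> on the real line, each of which is at most \<open>|a\<^sub>i\<^sub>k|\<close>, and
  is positive iff \<open>a\<^sub>i\<^sub>k\<close> and \<open>a\<^sub>j\<^sub>k\<close> have the same strict sign. On edges all of them vanish, so the
  indices of a fixed strict sign form an independent set, whence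
  \<open>\<Sum>\<^sub>i\<^sub>j x\<^sub>i \<cdot> x\<^sub>j \<le> \<alpha> D\<close> for the independence number \<open>\<alpha> = |V| - vc\<close>. Therefore \<open>D \<le> 4 \<alpha>\<close>.
\<close>

text \<open>The Gromov product based at 0: the length that the segments from 0 to \<open>a\<close>
  and from 0 to \<open>b\<close> share.\<close>

definition gromov :: "real \<Rightarrow> real \<Rightarrow> real" where
  "gromov a b = (\<bar>a\<bar> + \<bar>b\<bar> - \<bar>a - b\<bar>) / 2"

lemma gromov_nonneg: "gromov a b \<ge> 0"
  by (simp add: gromov_def abs_if)

lemma gromov_le: "gromov a b \<le> \<bar>a\<bar>"
  by (simp add: gromov_def abs_if)

lemma gromov_pos_iff: "gromov a b > 0 \<longleftrightarrow> a * b > 0"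
  by (auto simp: gromov_def zero_less_mult_iff abs_if)

lemma l2_norm_squared: "(l2_norm m x)\<^sup>2 = (\<Sum>k<m. (x k)\<^sup>2)"
  by (simp add: l2_norm_def L2_set_def sum_nonneg)

lemma finite_vertex_covers:
  assumes "finite_graph V E"
  shows "finite {S. vertex_cover V E S}"
  by (rule finite_subset[of _ "Pow V"]) (use assms in \<open>auto simp: vertex_cover_def finite_graph_def\<close>)

lemma vc_le_card:
  assumes "finite_graph V E" "vertex_cover V E S"
  shows "vc V E \<le> card S"
  unfolding vc_def using assms by (auto intro!: Min_le finite_vertex_covers)

lemma minimum_vertex_cover_exists:
  assumes "finite_graph V E"
  obtains S where "vertex_cover V E S" "card S = vc V E"
proof -
  \<comment> \<open>Edges are nonempty, so \<open>V\<close> itself is a cover and the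
    \<open>Min\<close> in \<open>vc\<close> ranges over a nonempty set.\<close>
  have "e \<subseteq> V \<and> e \<noteq> {}" if "e \<in> E" for e
    using that assms by (auto simp: finite_graph_def)
  then have "vertex_cover V E V"
    by (auto simp: vertex_cover_def)
  then have "vc V E \<in> card ` {S. vertex_cover V E S}"
    unfolding vc_def by (intro Min_in) (auto intro: finite_vertex_covers[OF assms])
  with that show thesis by auto
qed

text \<open>The complement of an independent set is a vertex cover.\<close>

lemma card_independent_le:
  assumes G: "finite_graph V E" and "I \<subseteq> V"
    and indep: "\<And>i j. i \<in> I \<Longrightarrow> j \<in> I \<Longrightarrow> {i, j} \<notin> E"
  shows "real (card I) \<le> real (card V) - real (vc V E)"
proof -
  have "vertex_cover V E (V - I)"
    unfolding vertex_cover_def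
  proof (intro conjI ballI)
    fix e assume "e \<in> E"
    then obtain i j where "e = {i, j}" "e \<subseteq> V"
      using G by (auto simp: finite_graph_def card_2_iff)
    with \<open>e \<in> E\<close> indep show "(V - I) \<inter> e \<noteq> {}" by blast
  qed auto
  then have "vc V E \<le> card (V - I)"
    by (rule vc_le_card[OF G])
  moreover have "finite V" using G by (simp add: finite_graph_def)
  ultimately show ?thesis
    using \<open>I \<subseteq> V\<close> card_mono[of V I] by (simp add: card_Diff_subset finite_subset)
qed

lemma sum_gromov_le:
  fixes a :: "'a \<Rightarrow> real"
  assumes G: "finite_graph V E"
    and edge: "\<And>i j. {i, j} \<in> E \<Longrightarrow> gromov (a i) (a j) = 0"
  shows "(\<Sum>j\<in>V. gromov (a i) (a j)) \<le> (real (card V) - real (vc V E)) * \<bar>a i\<bar>"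
proof -
  define I where "I = {j \<in> V. a i * a j > 0}"
  have fin: "finite V" using G by (simp add: finite_graph_def)
  have "(\<Sum>j\<in>V. gromov (a i) (a j)) = (\<Sum>j\<in>I. gromov (a i) (a j))"
  proof (rule sum.mono_neutral_right)
    show "\<forall>j\<in>V - I. gromov (a i) (a j) = 0"
      using gromov_pos_iff gromov_nonneg by (auto simp: I_def order.order_iff_strict)
  qed (auto simp: fin I_def)
  also have "\<dots> \<le> real (card I) * \<bar>a i\<bar>"
    by (rule sum_bounded_above) (rule gromov_le)
  also have "\<dots> \<le> (real (card V) - real (vc V E)) * \<bar>a i\<bar>"
  proof (intro mult_right_mono card_independent_le[OF G])
    fix j l assume "j \<in> I" "l \<in> I"
    \<comment> \<open>Both \<open>a j\<close> and \<open>a l\<close> have the strict sign of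
      \<open>a i\<close>.\<close>
    then have "a j * a l > 0"
      by (auto simp: I_def zero_less_mult_iff)
    then have "gromov (a j) (a l) > 0"
      by (simp add: gromov_pos_iff)
    with edge show "{j, l} \<notin> E" by force
  qed (auto simp: I_def)
  finally show ?thesis .
qed

text \<open>The Cauchy-Schwarz step, with \<open>u\<close> standing for the antipode of the vector
  at index 0; it yields a quadratic inequality in the total squared distance.\<close>

lemma sum_squared_dist_le:
  fixes x :: "'a \<Rightarrow> nat \<Rightarrow> real" and u :: "nat \<Rightarrow> real"
  assumes unit: "(\<Sum>k<m. (u k)\<^sup>2) = 1"
    and sphere: "\<And>i. i \<in> V \<Longrightarrow> (\<Sum>k<m. (x i k)\<^sup>2) = 2 * (\<Sum>k<m. x i k * u k)"
    and gram: "(\<Sum>i\<in>V. \<Sum>j\<in>V. \<Sum>k<m. x i k * x j k) \<le> \<alpha> * (\<Sum>i\<in>V. \<Sum>k<m. (x i k)\<^sup>2)"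
    and "\<alpha> \<ge> 0"
  shows "(\<Sum>i\<in>V. \<Sum>k<m. (x i k)\<^sup>2) \<le> 4 * \<alpha>"
proof -
  define D where "D = (\<Sum>i\<in>V. \<Sum>k<m. (x i k)\<^sup>2)"
  define y where "y k = (\<Sum>i\<in>V. x i k)" for k
  have "D = 2 * (\<Sum>i\<in>V. \<Sum>k<m. x i k * u k)"
    unfolding D_def by (simp add: sphere sum_distrib_left cong: sum.cong)
  also have "(\<Sum>i\<in>V. \<Sum>k<m. x i k * u k) = (\<Sum>k<m. y k * u k)"
    by (subst sum.swap) (simp add: y_def sum_distrib_right)
  finally have "D\<^sup>2 = 4 * (\<Sum>k<m. y k * u k)\<^sup>2"
    by (simp add: power_mult_distrib)
  also have "\<dots> \<le> 4 * ((\<Sum>k<m. (y k)\<^sup>2) * (\<Sum>k<m. (u k)\<^sup>2))"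
    by (intro mult_left_mono Cauchy_Schwarz_ineq_sum) simp
  also have "\<dots> = 4 * (\<Sum>k<m. \<Sum>i\<in>V. \<Sum>j\<in>V. x i k * x j k)"
    by (simp add: unit) (simp add: y_def power2_eq_square sum_product)
  also have "(\<Sum>k<m. \<Sum>i\<in>V. \<Sum>j\<in>V. x i k * x j k) = (\<Sum>i\<in>V. \<Sum>k<m. \<Sum>j\<in>V. x i k * x j k)"
    by (rule sum.swap)
  also have "\<dots> = (\<Sum>i\<in>V. \<Sum>j\<in>V. \<Sum>k<m. x i k * x j k)"
    by (intro sum.cong refl sum.swap)
  finally have "D * D \<le> (4 * \<alpha>) * D"
    using gram by (simp add: D_def power2_eq_square)
  moreover have "D \<ge> 0"
    by (simp add: D_def sum_nonneg)
  ultimately have "D \<le> 4 * \<alpha>"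
    using \<open>\<alpha> \<ge> 0\<close> by (cases "D = 0") (auto simp: mult_le_cancel_right)
  then show ?thesis by (simp add: D_def)
qed

lemma vc_le_objective:
  assumes G: "finite_graph V E" and feas: "feasible V E m v"
  shows "real (vc V E) \<le> objective V m v"
proof -
  define \<alpha> where "\<alpha> = real (card V) - real (vc V E)"
  define u where "u = v None"
  define x where "x i k = v (Some i) k - u k" for i k
  have "l1_embeddable (v ` indices V) (\<lambda>p q. (l2_norm m (p - q))\<^sup>2)"
    using feas by (simp add: feasible_def)
  then obtain M \<phi> where
    "\<forall>p\<in>v ` indices V. \<forall>q\<in>v ` indices V. l1_norm M (\<phi> p - \<phi> q) = (l2_norm m (p - q))\<^sup>2"
    unfolding l1_embeddable_def by (elim exE bexE)
  then have \<phi>: "l1_norm M (\<phi> (v i) - \<phi> (v j)) = (l2_norm m (v i - v j))\<^sup>2"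
    if "i \<in> indices V" "j \<in> indices V" for i j
    using that by simp
  define a where "a i k = \<phi> (v (Some i)) k - \<phi> u k" for i k

  have dist0: "(\<Sum>k<m. (x i k)\<^sup>2) = (\<Sum>k<M. \<bar>a i k\<bar>)" if "i \<in> V" for i
    using \<phi>[of "Some i" None] that
    by (simp add: l2_norm_squared l1_norm_def a_def x_def u_def indices_def)
  have dist: "(\<Sum>k<m. (x i k - x j k)\<^sup>2) = (\<Sum>k<M. \<bar>a i k - a j k\<bar>)" if "i \<in> V" "j \<in> V" for i j
    using \<phi>[of "Some i" "Some j"] that
    by (simp add: l2_norm_squared l1_norm_def a_def x_def u_def indices_def)
  have inner: "(\<Sum>k<m. x i k * x j k) = (\<Sum>k<M. gromov (a i k) (a j k))"
    if "i \<in> V" "j \<in> V" for i j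
  proof -
    have "(\<Sum>k<m. x i k * x j k)
        = (\<Sum>k<m. ((x i k)\<^sup>2 + (x j k)\<^sup>2 - (x i k - x j k)\<^sup>2) / 2)"
      by (simp add: power2_diff)
    also have "\<dots>
        = ((\<Sum>k<m. (x i k)\<^sup>2) + (\<Sum>k<m. (x j k)\<^sup>2) - (\<Sum>k<m. (x i k - x j k)\<^sup>2)) / 2"
      by (simp only: sum.distrib sum_subtractf flip: sum_divide_distrib)
    also have "\<dots> = (\<Sum>k<M. gromov (a i k) (a j k))"
      by (simp add: that dist0 dist gromov_def sum.distrib sum_subtractf flip: sum_divide_distrib)
    finally show ?thesis .
  qed
  have edge: "gromov (a i k) (a j k) = 0" if "{i, j} \<in> E" "k < M" for i j k
  proof -
    have V: "i \<in> V" "j \<in> V"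
      using that G by (auto simp: finite_graph_def)
    have "(\<Sum>k<m. (x i k)\<^sup>2) + (\<Sum>k<m. (x j k)\<^sup>2) = (\<Sum>k<m. (x i k - x j k)\<^sup>2)"
      using feas that by (simp add: feasible_def l2_norm_squared x_def u_def)
    \<comment> \<open>The orthogonality on an edge makes the sum of these nonnegative products
      vanish, hence each of them.\<close>
    then have "(\<Sum>k<M. gromov (a i k) (a j k)) = 0"
      by (simp add: V dist0 dist gromov_def sum.distrib sum_subtractf flip: sum_divide_distrib)
    then show ?thesis
      using that by (simp add: sum_nonneg_eq_0_iff gromov_nonneg)
  qed

  have unit: "(\<Sum>k<m. (u k)\<^sup>2) = 1"
    using feas by (simp add: feasible_def indices_def u_def flip: l2_norm_squared)
  have "(\<Sum>i\<in>V. \<Sum>k<m. (x i k)\<^sup>2) \<le> 4 * \<alpha>"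
  proof (rule sum_squared_dist_le)
    show "(\<Sum>k<m. (- u k)\<^sup>2) = 1" using unit by simp
    show "(\<Sum>k<m. (x i k)\<^sup>2) = 2 * (\<Sum>k<m. x i k * - u k)" if "i \<in> V" for i
    proof -
      have "(\<Sum>k<m. (v (Some i) k)\<^sup>2) = 1"
        using feas that by (simp add: feasible_def indices_def flip: l2_norm_squared)
      moreover have "(\<Sum>k<m. (v (Some i) k)\<^sup>2)
          = (\<Sum>k<m. (x i k)\<^sup>2 - 2 * (x i k * - u k) + (u k)\<^sup>2)"
        by (intro sum.cong refl) (simp add: x_def power2_eq_square algebra_simps)
      then have "(\<Sum>k<m. (v (Some i) k)\<^sup>2)
          = (\<Sum>k<m. (x i k)\<^sup>2) - 2 * (\<Sum>k<m. x i k * - u k) + (\<Sum>k<m. (u k)\<^sup>2)"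
        unfolding sum.distrib sum_subtractf sum_distrib_left .
      ultimately show ?thesis using unit by linarith
    qed
    \<comment> \<open>With the coordinate \<open>k\<close> fixed before the sum over
      \<open>j\<close>, \<open>sum_gromov_le\<close> applies to each coordinate separately.\<close>
    have "(\<Sum>i\<in>V. \<Sum>j\<in>V. \<Sum>k<m. x i k * x j k) = (\<Sum>i\<in>V. \<Sum>k<M. \<Sum>j\<in>V. gromov (a i k) (a j k))"
      by (intro sum.cong refl, subst sum.swap) (simp add: inner)
    also have "\<dots> \<le> (\<Sum>i\<in>V. \<Sum>k<M. \<alpha> * \<bar>a i k\<bar>)"
      unfolding \<alpha>_def by (intro sum_mono sum_gromov_le[OF G, where a = "\<lambda>i. a i _"] edge) auto
    also have "\<dots> = \<alpha> * (\<Sum>i\<in>V. \<Sum>k<m. (x i k)\<^sup>2)"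
      by (simp add: dist0 sum_distrib_left)
    finally show "(\<Sum>i\<in>V. \<Sum>j\<in>V. \<Sum>k<m. x i k * x j k) \<le> \<alpha> * (\<Sum>i\<in>V. \<Sum>k<m. (x i k)\<^sup>2)" .
    show "\<alpha> \<ge> 0"
      using card_independent_le[OF G, of "{}"] by (simp add: \<alpha>_def)
  qed
  moreover have "objective V m v = real (card V) - (\<Sum>i\<in>V. \<Sum>k<m. (x i k)\<^sup>2) / 4"
    by (simp add: objective_def l2_norm_squared x_def u_def sum_subtractf
          power2_commute[of "v None _"] flip: sum_divide_distrib)
  ultimately show ?thesis by (simp add: \<alpha>_def)
qed

lemma vertex_cover_feasible:
  assumes G: "finite_graph V E" and S: "vertex_cover V E S"
  obtains v where "feasible V E 1 v" "objective V 1 v = real (card S)"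
proof -
  define s :: "'a option \<Rightarrow> real" where
    "s i = (case i of None \<Rightarrow> 1 | Some j \<Rightarrow> if j \<in> S then 1 else - 1)" for i
  define v :: "'a option \<Rightarrow> nat \<Rightarrow> real" where "v i k = (if k = 0 then s i else 0)" for i k
  have s: "s i = 1 \<or> s i = - 1" for i
    by (auto simp: s_def split: option.split)
  have "l1_embeddable (v ` indices V) (\<lambda>p q. (l2_norm 1 (p - q))\<^sup>2)"
    unfolding l1_embeddable_def
  \<comment> \<open>Coordinates are 1 or -1, so a difference is 0 or has modulus 2, and its square
    is twice its modulus; hence the factor 2.\<close>
  proof (intro exI[of _ 1] bexI[of _ "\<lambda>p k. 2 * p k"] ballI)
    fix p q assume "p \<in> v ` indices V" "q \<in> v ` indices V"
    then obtain i j where "p = v i" "q = v j" by auto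
    then show "l1_norm 1 ((\<lambda>k. 2 * p k) - (\<lambda>k. 2 * q k)) = (l2_norm 1 (p - q))\<^sup>2"
      using s[of i] s[of j] by (auto simp: l1_norm_def l2_norm_squared v_def)
  qed (auto simp: topspace_Euclidean_space v_def)
  \<comment> \<open>An endpoint in \<open>S\<close> coincides with \<open>v None\<close>, which
    makes the edge equation trivial.\<close>
  moreover have "i \<in> S \<or> j \<in> S" if "{i, j} \<in> E" for i j
    using S that by (auto simp: vertex_cover_def)
  ultimately have "feasible V E 1 v"
    using s unfolding feasible_def
    by (auto simp: topspace_Euclidean_space v_def l2_norm_squared s_def l2_norm_def L2_set_def
          split: option.split)
  \<comment> \<open>Antipodal points have squared distance 4, so vertices outside \<open>S\<close>
    contribute 0.\<close>
  moreover have "objective V 1 v = (\<Sum>i\<in>V. if i \<in> S then 1 else 0)"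
    unfolding objective_def
    by (intro sum.cong refl) (simp add: l2_norm_squared v_def s_def)
  then have "objective V 1 v = real (card S)"
    using G S by (simp add: sum.If_cases finite_graph_def vertex_cover_def Int_absorb1)
  ultimately show thesis by (rule that)
qed

theorem theorem2:
  fixes V :: "'a set" and E :: "'a set set"
  assumes "finite_graph V E"
  shows "optimal_value V E = ereal (real (vc V E))"
proof (rule antisym)
  obtain S where "vertex_cover V E S" "card S = vc V E"
    by (rule minimum_vertex_cover_exists[OF assms])
  then obtain v where "feasible V E 1 v" "objective V 1 v = real (vc V E)"
    using vertex_cover_feasible[OF assms] by metis
  then show "optimal_value V E \<le> ereal (real (vc V E))"
    unfolding optimal_value_def by (intro Inf_lower CollectI) metis
  show "ereal (real (vc V E)) \<le> optimal_value V E"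
    unfolding optimal_value_def
    by (intro Inf_greatest) (auto intro: vc_le_objective[OF assms])
qed

end
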